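(* Let $\rho$ be a polarity of $\mathrm{PG}(2,q^3)$ commuting with $\alpha$, and let $\rho_{\mathcal{F}}$ be the induced polarity of the Figueroa plane $\mathcal{F}$. Let $\mathcal{Z}$ be a set of points of $\mathrm{PG}(2,q^3)$, none absolute with respect to $\rho$, containing no self-polar triangle with respect to $\rho$. Then \[\mathcal{Z}_{\mathcal{F}}=(\mathcal{Z}\cap\mathcal{O}_1)\cup\{x^{\mu\rho} : x\in\mathcal{Z}\cap\mathcal{O}_3\}\] is a set of points of $\mathcal{F}$, none absolute with respect to $\rho_{\mathcal{F}}$, containing no self-polar triangle with respect to $\rho_{\mathcal{F}}$.
   Context: Let $q>2$ be a prime power and $\alpha$ a collineation of order $3$ of $\mathrm{PG}(2,q^3)$ whose fixed points form a subplane isomorphic to $\mathrm{PG}(2,q)$. Point classes: $x\in\mathcal{O}_1$ if $x^\alpha=x$, $x\in\mathcal{O}_2$ if $x,x^\alpha,x^{\alpha^2}$ are distinct and collinear, $x\in\mathcal{O}_3$ if distinct and not collinear; line classes $\mathcal{L}_1,\mathcal{L}_2,\mathcal{L}_3$ dually. $\mu$ maps $x\in\mathcal{O}_3$ to the line $x^\alpha x^{\alpha^2}$ and $\ell\in\mathcal{L}_3$ to the point $\ell^\alpha\cap\ell^{\alpha^2}$; maps are written as exponents composed left to right, so $x^{\mu\rho}=(x^\mu)^\rho$. The Figueroa plane $\mathcal{F}$ has the points of $\mathrm{PG}(2,q^3)$; its lines are the lines of $\mathcal{L}_1\cup\mathcal{L}_2$ (as point sets) and, for each $\ell\in\mathcal{L}_3$,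 the set $\ell_{\mathcal{F}}$ of points of $\ell$ in $\mathcal{O}_1\cup\mathcal{O}_2$ together with the points $P\in\mathcal{O}_3$ with $\ell^\mu\in P^\mu$. For a polarity $\rho$ of $\mathrm{PG}(2,q^3)$ with $\rho\alpha=\alpha\rho$, the polarity $\rho_{\mathcal{F}}$ of $\mathcal{F}$ is: $\rho_{\mathcal{F}}=\rho$ on points of $\mathcal{O}_1\cup\mathcal{O}_2$ and lines of $\mathcal{L}_1\cup\mathcal{L}_2$; $x^{\rho_{\mathcal{F}}}=(x^\rho)_{\mathcal{F}}$ for $x\in\mathcal{O}_3$; $(\ell_{\mathcal{F}})^{\rho_{\mathcal{F}}}=\ell^\rho$ for $\ell\in\mathcal{L}_3$. A point $x$ is absolute for a polarity $\sigma$ if $x$ lies on $x^\sigma$. A self-polar triangle is a set of three distinct points each lying on the polar lines of the other two. *)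

theory Defs
  imports "HOL-Analysis.Cartesian_Space" "HOL-Number_Theory.Prime_Powers"
begin

text \<open>Lines are sets of points and incidence is membership, both in the Desarguesian plane
  and in the Figueroa plane.\<close>

record 'p incidence_structure =
  points :: "'p set"
  lines :: "'p set set"

definition isomorphic :: "'p incidence_structure \<Rightarrow> 'r incidence_structure \<Rightarrow> bool" where
  "isomorphic A B \<longleftrightarrow>
     (\<exists>f. bij_betw f (points A) (points B) \<and> bij_betw ((`) f) (lines A) (lines B))"

definition pg2_points :: "('a::field ^ 3) set set" where
  "pg2_points = {U. vec.subspace U \<and> vec.dim U = 1}"

text \<open>\<open>PG2\<close> at type \<open>('a ^ 3) set\<close> is the projective plane over the field \<open>'a\<close>, that is,
  \<open>PG(2, CARD('a))\<close> when \<open>'a\<close> is finite.  A 2-dimensional subspace is identified with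
  the set of 1-dimensional subspaces contained in it.\<close>

definition PG2 :: "('a::field ^ 3) set incidence_structure" where
  "PG2 = \<lparr> points = pg2_points,
           lines = {{U \<in> pg2_points. U \<subseteq> W} | W. vec.subspace W \<and> vec.dim W = 2} \<rparr>"

text \<open>\<open>join\<close> and \<open>meet\<close> are meaningful only for two distinct points, respectively two
  distinct lines, of a projective plane.\<close>

definition join :: "'p incidence_structure \<Rightarrow> 'p \<Rightarrow> 'p \<Rightarrow> 'p set" where
  "join A x y = (THE l. l \<in> lines A \<and> x \<in> l \<and> y \<in> l)"

definition meet :: "'p incidence_structure \<Rightarrow> 'p set \<Rightarrow> 'p set \<Rightarrow> 'p" where
  "meet A l m = (THE x. x \<in> points A \<and> x \<in> l \<and> x \<in> m)"

text \<open>A collineation \<open>\<alpha>\<close> is given by its action on points; a line \<open>l\<close> is mapped to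
  the image \<open>\<alpha> ` l\<close>.\<close>

definition collineation :: "'p incidence_structure \<Rightarrow> ('p \<Rightarrow> 'p) \<Rightarrow> bool" where
  "collineation A \<alpha> \<longleftrightarrow>
     bij_betw \<alpha> (points A) (points A) \<and> bij_betw ((`) \<alpha>) (lines A) (lines A)"

definition has_order :: "'p incidence_structure \<Rightarrow> ('p \<Rightarrow> 'p) \<Rightarrow> nat \<Rightarrow> bool" where
  "has_order A \<alpha> n \<longleftrightarrow>
     0 < n \<and> (\<forall>x\<in>points A. (\<alpha> ^^ n) x = x) \<and>
     (\<forall>m. 0 < m \<and> m < n \<longrightarrow> (\<exists>x\<in>points A. (\<alpha> ^^ m) x \<noteq> x))"

definition O1 :: "'p incidence_structure \<Rightarrow> ('p \<Rightarrow> 'p) \<Rightarrow> 'p set" where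
  "O1 A \<alpha> = {x \<in> points A. \<alpha> x = x}"

definition O2 :: "'p incidence_structure \<Rightarrow> ('p \<Rightarrow> 'p) \<Rightarrow> 'p set" where
  "O2 A \<alpha> = {x \<in> points A. distinct [x, \<alpha> x, \<alpha> (\<alpha> x)] \<and>
     (\<exists>l\<in>lines A. x \<in> l \<and> \<alpha> x \<in> l \<and> \<alpha> (\<alpha> x) \<in> l)}"

definition O3 :: "'p incidence_structure \<Rightarrow> ('p \<Rightarrow> 'p) \<Rightarrow> 'p set" where
  "O3 A \<alpha> = {x \<in> points A. distinct [x, \<alpha> x, \<alpha> (\<alpha> x)] \<and>
     \<not> (\<exists>l\<in>lines A. x \<in> l \<and> \<alpha> x \<in> l \<and> \<alpha> (\<alpha> x) \<in> l)}"

definition L1 :: "'p incidence_structure \<Rightarrow> ('p \<Rightarrow> 'p) \<Rightarrow> 'p set set" where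
  "L1 A \<alpha> = {l \<in> lines A. \<alpha> ` l = l}"

definition L2 :: "'p incidence_structure \<Rightarrow> ('p \<Rightarrow> 'p) \<Rightarrow> 'p set set" where
  "L2 A \<alpha> = {l \<in> lines A. distinct [l, \<alpha> ` l, \<alpha> ` \<alpha> ` l] \<and>
     (\<exists>x\<in>points A. x \<in> l \<and> x \<in> \<alpha> ` l \<and> x \<in> \<alpha> ` \<alpha> ` l)}"

definition L3 :: "'p incidence_structure \<Rightarrow> ('p \<Rightarrow> 'p) \<Rightarrow> 'p set set" where
  "L3 A \<alpha> = {l \<in> lines A. distinct [l, \<alpha> ` l, \<alpha> ` \<alpha> ` l] \<and>
     \<not> (\<exists>x\<in>points A. x \<in> l \<and> x \<in> \<alpha> ` l \<and> x \<in> \<alpha> ` \<alpha> ` l)}"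

text \<open>The structure induced on the fixed points: its lines are the traces of those lines that
  contain at least two fixed points.\<close>

definition fixed_substructure ::
    "'p incidence_structure \<Rightarrow> ('p \<Rightarrow> 'p) \<Rightarrow> 'p incidence_structure" where
  "fixed_substructure A \<alpha> =
     \<lparr> points = O1 A \<alpha>,
       lines = {l \<inter> O1 A \<alpha> | l. l \<in> lines A \<and>
                 (\<exists>x\<in>l \<inter> O1 A \<alpha>. \<exists>y\<in>l \<inter> O1 A \<alpha>. x \<noteq> y)} \<rparr>"

text \<open>The map \<open>\<mu>\<close>, on points of \<open>O3\<close> and on lines of \<open>L3\<close>.\<close>

definition mu_point :: "'p incidence_structure \<Rightarrow> ('p \<Rightarrow> 'p) \<Rightarrow> 'p \<Rightarrow> 'p set" where
  "mu_point A \<alpha> x = join A (\<alpha> x) (\<alpha> (\<alpha> x))"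

definition mu_line :: "'p incidence_structure \<Rightarrow> ('p \<Rightarrow> 'p) \<Rightarrow> 'p set \<Rightarrow> 'p" where
  "mu_line A \<alpha> l = meet A (\<alpha> ` l) (\<alpha> ` \<alpha> ` l)"

definition figueroa_line ::
    "'p incidence_structure \<Rightarrow> ('p \<Rightarrow> 'p) \<Rightarrow> 'p set \<Rightarrow> 'p set" where
  "figueroa_line A \<alpha> l =
     (l \<inter> (O1 A \<alpha> \<union> O2 A \<alpha>)) \<union> {x \<in> O3 A \<alpha>. mu_line A \<alpha> l \<in> mu_point A \<alpha> x}"

definition figueroa ::
    "'p incidence_structure \<Rightarrow> ('p \<Rightarrow> 'p) \<Rightarrow> 'p incidence_structure" where
  "figueroa A \<alpha> =
     \<lparr> points = points A,
       lines = L1 A \<alpha> \<union> L2 A \<alpha> \<union> figueroa_line A \<alpha> ` L3 A \<alpha> \<rparr>"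

text \<open>A correlation consists of its action on points and its action on lines.\<close>

record 'p correlation =
  polar :: "'p \<Rightarrow> 'p set"
  pole :: "'p set \<Rightarrow> 'p"

definition polarity :: "'p incidence_structure \<Rightarrow> 'p correlation \<Rightarrow> bool" where
  "polarity A \<rho> \<longleftrightarrow>
     (\<forall>x\<in>points A. polar \<rho> x \<in> lines A \<and> pole \<rho> (polar \<rho> x) = x) \<and>
     (\<forall>l\<in>lines A. pole \<rho> l \<in> points A \<and> polar \<rho> (pole \<rho> l) = l) \<and>
     (\<forall>x\<in>points A. \<forall>l\<in>lines A. x \<in> l \<longleftrightarrow> pole \<rho> l \<in> polar \<rho> x)"

definition commutes_with ::
    "'p incidence_structure \<Rightarrow> 'p correlation \<Rightarrow> ('p \<Rightarrow> 'p) \<Rightarrow> bool" where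
  "commutes_with A \<rho> \<alpha> \<longleftrightarrow>
     (\<forall>x\<in>points A. polar \<rho> (\<alpha> x) = \<alpha> ` polar \<rho> x) \<and>
     (\<forall>l\<in>lines A. pole \<rho> (\<alpha> ` l) = \<alpha> (pole \<rho> l))"

definition absolute :: "'p correlation \<Rightarrow> 'p \<Rightarrow> bool" where
  "absolute \<rho> x \<longleftrightarrow> x \<in> polar \<rho> x"

definition self_polar_triangle :: "'p correlation \<Rightarrow> 'p set \<Rightarrow> bool" where
  "self_polar_triangle \<rho> T \<longleftrightarrow>
     card T = 3 \<and> (\<forall>x\<in>T. \<forall>y\<in>T. x \<noteq> y \<longrightarrow> x \<in> polar \<rho> y)"

definition figueroa_polarity ::
    "'p incidence_structure \<Rightarrow> ('p \<Rightarrow> 'p) \<Rightarrow> 'p correlation \<Rightarrow> 'p correlation" where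
  "figueroa_polarity A \<alpha> \<rho> =
     \<lparr> polar = (\<lambda>x. if x \<in> O1 A \<alpha> \<union> O2 A \<alpha> then polar \<rho> x
                     else figueroa_line A \<alpha> (polar \<rho> x)),
       pole = (\<lambda>m. if m \<in> L1 A \<alpha> \<union> L2 A \<alpha> then pole \<rho> m
                     else pole \<rho> (THE l. l \<in> L3 A \<alpha> \<and> figueroa_line A \<alpha> l = m)) \<rparr>"

definition figueroa_set ::
    "'p incidence_structure \<Rightarrow> ('p \<Rightarrow> 'p) \<Rightarrow> 'p correlation \<Rightarrow> 'p set \<Rightarrow> 'p set" where
  "figueroa_set A \<alpha> \<rho> Z =
     (Z \<inter> O1 A \<alpha>) \<union> {pole \<rho> (mu_point A \<alpha> x) | x. x \<in> Z \<inter> O3 A \<alpha>}"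

end

theory Submission imports Defs begin

text \<open>The map \<open>\<phi>\<close> that is the identity on \<open>O1\<close> and
  \<open>x \<mapsto> x\<^sup>\<mu>\<^sup>\<rho>\<close> on \<open>O3\<close> satisfies: if \<open>\<phi> u\<close> lies on the
  \<open>\<rho>\<^sub>\<F>\<close>-polar of \<open>\<phi> v\<close>, then \<open>u\<close> lies on the \<open>\<rho>\<close>-polar of \<open>v\<close>.
  For \<open>u\<close>, \<open>v\<close> in \<open>O3\<close> this holds because \<open>v\<^sup>\<mu>\<^sup>\<mu> = v\<close> and
  \<open>(\<phi> u)\<^sup>\<mu> = u\<^sup>\<rho>\<close>; mixed pairs never arise, since no point of \<open>O1\<close> lies on a line
  of \<open>L3\<close> and no point of \<open>O3\<close> on a line of \<open>L1\<close>.  Hence absolute points and self-polar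
  triangles pull back along \<open>\<phi>\<close>.\<close>

section \<open>Joining points of the Desarguesian plane\<close>

lemma pg2_point_span:
  fixes U :: "('a::field ^ 3) set"
  assumes "U \<in> pg2_points"
  obtains u where "U = vec.span {u}"
proof -
  from assms have U: "vec.subspace U" "vec.dim U = 1"
    by (auto simp: pg2_points_def)
  obtain B where B: "B \<subseteq> U" "vec.independent B" "U \<subseteq> vec.span B" "card B = vec.dim U"
    using vec.basis_exists by blast
  then obtain u where "B = {u}"
    using U(2) card_1_singletonE by metis
  then have "U = vec.span {u}"
    using B U(1) vec.span_subspace by blast
  then show thesis by (rule that)
qed

text \<open>Two generators bound the dimension above by 2. If it were at most 1, the one-dimensional
  subspaces \<open>U\<close> and \<open>V\<close> would both fill the span and so coincide.\<close>

lemma pg2_dim_span_Un: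
  fixes U V :: "('a::field ^ 3) set"
  assumes "U \<in> pg2_points" "V \<in> pg2_points" "U \<noteq> V"
  shows "vec.dim (vec.span (U \<union> V)) = 2"
proof -
  from assms have U: "vec.subspace U" "vec.dim U = 1" and V: "vec.subspace V" "vec.dim V = 1"
    by (auto simp: pg2_points_def)
  obtain u v where u: "U = vec.span {u}" and v: "V = vec.span {v}"
    using assms(1,2) pg2_point_span by metis
  have "vec.span (U \<union> V) \<subseteq> vec.span {u, v}"
    unfolding u v by (intro vec.span_minimal Un_least vec.span_mono vec.subspace_span) auto
  then have "vec.dim (vec.span (U \<union> V)) \<le> card {u, v}"
    by (intro vec.dim_le_card) auto
  also have "\<dots> \<le> 2"
    by (simp add: card_insert_if)
  finally have le: "vec.dim (vec.span (U \<union> V)) \<le> 2" .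
  have "\<not> vec.dim (vec.span (U \<union> V)) \<le> 1"
  proof
    assume *: "vec.dim (vec.span (U \<union> V)) \<le> 1"
    have "U \<subseteq> vec.span (U \<union> V)" "V \<subseteq> vec.span (U \<union> V)"
      using vec.span_superset by blast+
    then have "U = vec.span (U \<union> V)" "V = vec.span (U \<union> V)"
      using * U V vec.subspace_dim_equal[OF _ vec.subspace_span] by metis+
    with assms(3) show False by simp
  qed
  with le show ?thesis by linarith
qed

text \<open>The line comes from the span of \<open>x \<union> y\<close>. Any two-dimensional
  subspace containing both points contains this span and equals it by dimension.\<close>

lemma PG2_unique_join:
  fixes x y :: "('a::field ^ 3) set"
  assumes "x \<in> points PG2" "y \<in> points PG2" "x \<noteq> y"
  shows "\<exists>!l. l \<in> lines PG2 \<and> x \<in> l \<and> y \<in> l"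
proof -
  have xy: "x \<in> pg2_points" "y \<in> pg2_points"
    using assms by (auto simp: PG2_def)
  define S where "S = vec.span (x \<union> y)"
  have S: "vec.subspace S" "vec.dim S = 2"
    using pg2_dim_span_Un[OF xy assms(3)] by (auto simp: S_def simp del: vec.dim_span)
  have "x \<subseteq> S" "y \<subseteq> S"
    unfolding S_def using vec.span_superset by blast+
  have uniq: "W = S" if "vec.subspace W" "vec.dim W = 2" "x \<subseteq> W" "y \<subseteq> W" for W
  proof -
    have "S \<subseteq> W"
      unfolding S_def using that by (intro vec.span_minimal) auto
    then show ?thesis
      using vec.subspace_dim_equal[OF S(1) that(1)] S(2) that(2) by simp
  qed
  let ?l = "{U \<in> pg2_points. U \<subseteq> S}"
  show ?thesis
  proof (rule ex1I[of _ ?l])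
    show "?l \<in> lines PG2 \<and> x \<in> ?l \<and> y \<in> ?l"
      using S xy \<open>x \<subseteq> S\<close> \<open>y \<subseteq> S\<close> unfolding PG2_def incidence_structure.simps by blast
  next
    fix l assume l: "l \<in> lines PG2 \<and> x \<in> l \<and> y \<in> l"
    then obtain W where W: "vec.subspace W" "vec.dim W = 2" "l = {U \<in> pg2_points. U \<subseteq> W}"
      unfolding PG2_def incidence_structure.simps by blast
    then have "x \<subseteq> W" "y \<subseteq> W"
      using l by blast+
    then show "l = ?l"
      using uniq[OF W(1,2)] W(3) by simp
  qed
qed

section \<open>Linear spaces with a commuting collineation and polarity\<close>

locale polarity_space =
  fixes A :: "'p incidence_structure" and \<alpha> :: "'p \<Rightarrow> 'p" and \<rho> :: "'p correlation"
  assumes unique_join: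
      "\<lbrakk>x \<in> points A; y \<in> points A; x \<noteq> y\<rbrakk> \<Longrightarrow> \<exists>!l. l \<in> lines A \<and> x \<in> l \<and> y \<in> l"
    and collineation: "collineation A \<alpha>"
    and cube: "x \<in> points A \<Longrightarrow> \<alpha> (\<alpha> (\<alpha> x)) = x"
    and polarity: "polarity A \<rho>"
    and commutes: "commutes_with A \<rho> \<alpha>"
begin

lemma alpha_point [simp]: "x \<in> points A \<Longrightarrow> \<alpha> x \<in> points A"
  using collineation bij_betwE unfolding collineation_def by blast

lemma alpha_line [simp]: "l \<in> lines A \<Longrightarrow> \<alpha> ` l \<in> lines A"
  using collineation bij_betwE unfolding collineation_def by blast

lemma polar_line [simp]: "x \<in> points A \<Longrightarrow> polar \<rho> x \<in> lines A"
  and pole_polar [simp]: "x \<in> points A \<Longrightarrow> pole \<rho> (polar \<rho> x) = x"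
  and pole_point [simp]: "l \<in> lines A \<Longrightarrow> pole \<rho> l \<in> points A"
  and polar_pole [simp]: "l \<in> lines A \<Longrightarrow> polar \<rho> (pole \<rho> l) = l"
  and incident_iff: "\<lbrakk>x \<in> points A; l \<in> lines A\<rbrakk> \<Longrightarrow> x \<in> l \<longleftrightarrow> pole \<rho> l \<in> polar \<rho> x"
  using polarity unfolding polarity_def by blast+

lemma polar_alpha: "x \<in> points A \<Longrightarrow> polar \<rho> (\<alpha> x) = \<alpha> ` polar \<rho> x"
  using commutes unfolding commutes_with_def by blast

lemma polar_sym:
  assumes "x \<in> points A" "y \<in> points A"
  shows "x \<in> polar \<rho> y \<longleftrightarrow> y \<in> polar \<rho> x"
  using incident_iff[OF assms(1) polar_line[OF assms(2)]] assms by simp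

text \<open>Used in two ways: as uniqueness of the joining line and, read contrapositively, as the
  fact that two distinct lines share at most one point.\<close>

lemma line_eq:
  assumes "x \<in> points A" "y \<in> points A" "x \<noteq> y" "l \<in> lines A" "m \<in> lines A"
    and "x \<in> l" "y \<in> l" "x \<in> m" "y \<in> m"
  shows "l = m"
  using unique_join[of x y] assms by blast

lemma join_eq:
  assumes "x \<in> points A" "y \<in> points A" "x \<noteq> y" "l \<in> lines A" "x \<in> l" "y \<in> l"
  shows "join A x y = l"
  unfolding join_def using assms line_eq[of x y] by (intro the_equality) blast+

section \<open>Points of \<open>O3\<close>, the triangles formed by their orbits, and the map
  \<mu>\<close>

lemma O3D:
  assumes "x \<in> O3 A \<alpha>"
  shows "x \<in> points A" "x \<noteq> \<alpha> x" "x \<noteq> \<alpha> (\<alpha> x)" "\<alpha> x \<noteq> \<alpha> (\<alpha> x)"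
    and "\<lbrakk>l \<in> lines A; x \<in> l; \<alpha> x \<in> l; \<alpha> (\<alpha> x) \<in> l\<rbrakk> \<Longrightarrow> False"
  using assms by (auto simp: O3_def)

lemma O3_disjoint: "x \<in> O3 A \<alpha> \<Longrightarrow> x \<notin> O1 A \<alpha> \<union> O2 A \<alpha>"
  unfolding O1_def O2_def O3_def by simp metis

context
  fixes x assumes x: "x \<in> O3 A \<alpha>"
begin

lemma mu_point_props:
  shows mu_line_in: "mu_point A \<alpha> x \<in> lines A"
    and mu_point_1: "\<alpha> x \<in> mu_point A \<alpha> x"
    and mu_point_2: "\<alpha> (\<alpha> x) \<in> mu_point A \<alpha> x"
proof -
  have "\<alpha> x \<in> points A" "\<alpha> (\<alpha> x) \<in> points A" "\<alpha> x \<noteq> \<alpha> (\<alpha> x)"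
    using O3D(1,4)[OF x] by simp_all
  \<comment> \<open>The description inside \<open>join\<close> is well defined because
    \<open>\<alpha> x\<close> and \<open>\<alpha> (\<alpha> x)\<close> are distinct.\<close>
  from theI'[OF unique_join[OF this]]
  show "mu_point A \<alpha> x \<in> lines A" "\<alpha> x \<in> mu_point A \<alpha> x" "\<alpha> (\<alpha> x) \<in> mu_point A \<alpha> x"
    unfolding mu_point_def join_def by blast+
qed

text \<open>The orbit of \<open>x\<close> is a triangle. The line
  \<open>mu_point A \<alpha> x\<close> is the side opposite \<open>x\<close>, and its images under
  \<alpha> and \<alpha>\<alpha> are the sides opposite \<open>\<alpha> x\<close> and
  \<open>\<alpha> (\<alpha> x)\<close>, since the cube of \<alpha> is the identity.\<close>

lemma mu_point_images:
  shows "\<alpha> (\<alpha> x) \<in> \<alpha> ` mu_point A \<alpha> x" "x \<in> \<alpha> ` mu_point A \<alpha> x"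
    "x \<in> \<alpha> ` \<alpha> ` mu_point A \<alpha> x" "\<alpha> x \<in> \<alpha> ` \<alpha> ` mu_point A \<alpha> x"
proof -
  have c: "\<alpha> (\<alpha> (\<alpha> x)) = x"
    using cube O3D(1)[OF x] .
  show 1: "\<alpha> (\<alpha> x) \<in> \<alpha> ` mu_point A \<alpha> x" and 2: "x \<in> \<alpha> ` mu_point A \<alpha> x"
    using imageI[OF mu_point_1, of \<alpha>] imageI[OF mu_point_2, of \<alpha>] c by simp_all
  show "x \<in> \<alpha> ` \<alpha> ` mu_point A \<alpha> x" "\<alpha> x \<in> \<alpha> ` \<alpha> ` mu_point A \<alpha> x"
    using imageI[OF 1, of \<alpha>] imageI[OF 2, of \<alpha>] c by simp_all
qed

text \<open>If two sides coincided, that line would contain all three vertices.\<close>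

lemma mu_point_ne: "mu_point A \<alpha> x \<noteq> \<alpha> ` mu_point A \<alpha> x"
  using O3D(5)[OF x mu_line_in] mu_point_1 mu_point_2 mu_point_images by metis

lemma mu_point_image_ne: "\<alpha> ` mu_point A \<alpha> x \<noteq> \<alpha> ` \<alpha> ` mu_point A \<alpha> x"
  using O3D(5)[OF x alpha_line[OF mu_line_in]] mu_point_images by metis

text \<open>The sides opposite the two other vertices are distinct and meet in the vertex
  \<open>x\<close>.\<close>

lemma mu_line_mu_point: "mu_line A \<alpha> (mu_point A \<alpha> x) = x"
  unfolding mu_line_def meet_def
proof (rule the_equality)
  show "x \<in> points A \<and> x \<in> \<alpha> ` mu_point A \<alpha> x \<and> x \<in> \<alpha> ` \<alpha> ` mu_point A \<alpha> x"
    using O3D(1)[OF x] mu_point_images by blast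
next
  fix y assume "y \<in> points A \<and> y \<in> \<alpha> ` mu_point A \<alpha> x \<and> y \<in> \<alpha> ` \<alpha> ` mu_point A \<alpha> x"
  then show "y = x"
    using line_eq[of y x "\<alpha> ` mu_point A \<alpha> x" "\<alpha> ` \<alpha> ` mu_point A \<alpha> x"]
      O3D(1)[OF x] mu_point_images mu_point_image_ne mu_line_in by auto
qed

text \<open>The first two sides meet only in \<open>\<alpha> (\<alpha> x)\<close> and the last two
  only in \<open>x\<close>, which are different vertices. This non-concurrence dualizes to
  non-collinearity of the poles of the sides.\<close>

lemma mu_point_no_common_point:
  assumes "y \<in> points A" "y \<in> mu_point A \<alpha> x" "y \<in> \<alpha> ` mu_point A \<alpha> x"
    "y \<in> \<alpha> ` \<alpha> ` mu_point A \<alpha> x"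
  shows False
proof -
  have "y = \<alpha> (\<alpha> x)"
    using line_eq[of y "\<alpha> (\<alpha> x)" "mu_point A \<alpha> x" "\<alpha> ` mu_point A \<alpha> x"] assms
      O3D(1)[OF x] mu_point_images(1) mu_point_2 mu_point_ne mu_line_in by auto
  moreover have "y = x"
    using line_eq[of y x "\<alpha> ` mu_point A \<alpha> x" "\<alpha> ` \<alpha> ` mu_point A \<alpha> x"] assms
      O3D(1)[OF x] mu_point_images mu_point_image_ne mu_line_in by auto
  ultimately show False
    using O3D(3)[OF x] by simp
qed

text \<open>A fixed point on one side would lie on all three images of that side.\<close>

lemma O1_not_in_mu_point: "y \<in> O1 A \<alpha> \<Longrightarrow> y \<notin> mu_point A \<alpha> x"
proof
  assume y: "y \<in> O1 A \<alpha>" "y \<in> mu_point A \<alpha> x"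
  then have *: "y \<in> points A" "\<alpha> y = y"
    by (auto simp: O1_def)
  then have 1: "y \<in> \<alpha> ` mu_point A \<alpha> x"
    using y(2) by (metis imageI)
  then have "y \<in> \<alpha> ` \<alpha> ` mu_point A \<alpha> x"
    using * by (metis imageI)
  with * y(2) 1 show False
    using mu_point_no_common_point by blast
qed

text \<open>As \<rho> commutes with \<alpha>, the polars of the orbit of \<open>y\<close> are the
  three sides of the triangle of \<open>x\<close>. Reversing incidence turns their non-concurrence
  into \<open>y \<in> O3 A \<alpha>\<close>, and turns the two sides through \<open>x\<close> into
  two points on \<open>polar \<rho> x\<close>.\<close>

lemma pole_mu_point:
  defines "y \<equiv> pole \<rho> (mu_point A \<alpha> x)"
  shows pole_mu_O3: "y \<in> O3 A \<alpha>"
    and polar_pole_mu: "polar \<rho> y = mu_point A \<alpha> x"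
    and mu_pole_mu: "mu_point A \<alpha> y = polar \<rho> x"
proof -
  have y: "y \<in> points A"
    using mu_line_in by (simp add: y_def)
  show p0: "polar \<rho> y = mu_point A \<alpha> x"
    using mu_line_in by (simp add: y_def)
  then have p1: "polar \<rho> (\<alpha> y) = \<alpha> ` mu_point A \<alpha> x"
    and p2: "polar \<rho> (\<alpha> (\<alpha> y)) = \<alpha> ` \<alpha> ` mu_point A \<alpha> x"
    using polar_alpha y by simp_all
  have n1: "y \<noteq> \<alpha> y"
    using p0 p1 mu_point_ne by metis
  have n2: "\<alpha> y \<noteq> \<alpha> (\<alpha> y)"
    using p1 p2 mu_point_image_ne by metis
  \<comment> \<open>Applying \<alpha> to \<open>y = \<alpha> (\<alpha> y)\<close> would give
    \<open>\<alpha> y = y\<close>.\<close>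
  have n3: "y \<noteq> \<alpha> (\<alpha> y)"
    using cube[OF y] n1 by metis
  have "\<not> (\<exists>l\<in>lines A. y \<in> l \<and> \<alpha> y \<in> l \<and> \<alpha> (\<alpha> y) \<in> l)"
  proof
    assume "\<exists>l\<in>lines A. y \<in> l \<and> \<alpha> y \<in> l \<and> \<alpha> (\<alpha> y) \<in> l"
    then obtain l where l: "l \<in> lines A" "y \<in> l" "\<alpha> y \<in> l" "\<alpha> (\<alpha> y) \<in> l"
      by blast
    \<comment> \<open>The pole of a line through the orbit of \<open>y\<close> would be a common
      point of the three sides.\<close>
    have "pole \<rho> l \<in> polar \<rho> y" "pole \<rho> l \<in> polar \<rho> (\<alpha> y)" "pole \<rho> l \<in> polar \<rho> (\<alpha> (\<alpha> y))"
      using l y incident_iff[OF _ l(1)] by simp_all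
    then show False
      using mu_point_no_common_point[of "pole \<rho> l"] l(1) p0 p1 p2 by simp
  qed
  then show "y \<in> O3 A \<alpha>"
    using y n1 n2 n3 by (simp add: O3_def)
  have "\<alpha> y \<in> polar \<rho> x" "\<alpha> (\<alpha> y) \<in> polar \<rho> x"
    using polar_sym[of _ x] y O3D(1)[OF x] p1 p2 mu_point_images by simp_all
  then show "mu_point A \<alpha> y = polar \<rho> x"
    unfolding mu_point_def using y n2 O3D(1)[OF x] by (intro join_eq) simp_all
qed

end

text \<open>The polar of a fixed point is a fixed line, so with \<open>y\<close> it would contain
  the whole orbit of \<open>y\<close>.\<close>

lemma O3_not_in_polar_O1:
  assumes "x \<in> O1 A \<alpha>" "y \<in> O3 A \<alpha>"
  shows "y \<notin> polar \<rho> x"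
proof
  assume y: "y \<in> polar \<rho> x"
  have x: "x \<in> points A" "\<alpha> x = x"
    using assms(1) by (auto simp: O1_def)
  then have "\<alpha> ` polar \<rho> x = polar \<rho> x"
    using polar_alpha by metis
  then have "\<alpha> y \<in> polar \<rho> x" "\<alpha> (\<alpha> y) \<in> polar \<rho> x"
    using y by blast+
  then show False
    using O3D(5)[OF assms(2) polar_line[OF x(1)] y] by blast
qed

section \<open>The map \<open>phi\<close> and the pullback of incidences along it\<close>

definition phi :: "'p \<Rightarrow> 'p" where
  "phi x = (if x \<in> O1 A \<alpha> then x else pole \<rho> (mu_point A \<alpha> x))"

lemma phi_O1: "x \<in> O1 A \<alpha> \<Longrightarrow> phi x = x"
  by (simp add: phi_def)

lemma phi_O3: "x \<in> O3 A \<alpha> \<Longrightarrow> phi x = pole \<rho> (mu_point A \<alpha> x)"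
  using O3_disjoint by (auto simp: phi_def)

text \<open>A single image lets both parts of the set be treated together. Points of
  \<open>Z\<close> in \<open>O2\<close> contribute nothing, so \<open>phi\<close> is evaluated only
  on \<open>O1\<close> and \<open>O3\<close>.\<close>

lemma figueroa_set_eq_phi: "figueroa_set A \<alpha> \<rho> Z = phi ` (Z \<inter> (O1 A \<alpha> \<union> O3 A \<alpha>))"
proof -
  have "phi ` (Z \<inter> O1 A \<alpha>) = (\<lambda>x. x) ` (Z \<inter> O1 A \<alpha>)"
    by (intro image_cong) (simp_all add: phi_O1)
  moreover have "phi ` (Z \<inter> O3 A \<alpha>) = (\<lambda>x. pole \<rho> (mu_point A \<alpha> x)) ` (Z \<inter> O3 A \<alpha>)"
    by (intro image_cong) (simp_all add: phi_O3)
  ultimately show ?thesis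
    unfolding figueroa_set_def Int_Un_distrib image_Un Setcompr_eq_image by simp
qed

lemma phi_point: "x \<in> O1 A \<alpha> \<union> O3 A \<alpha> \<Longrightarrow> phi x \<in> points A"
proof (cases "x \<in> O1 A \<alpha>")
  case True
  then show ?thesis
    unfolding phi_O1[OF True] by (simp add: O1_def)
next
  case False
  assume "x \<in> O1 A \<alpha> \<union> O3 A \<alpha>"
  with False have "x \<in> O3 A \<alpha>"
    by simp
  then show ?thesis
    using O3D(1)[OF pole_mu_O3] by (simp only: phi_O3)
qed

lemma polar_if_figueroa_polar_phi:
  assumes uv: "u \<in> O1 A \<alpha> \<union> O3 A \<alpha>" "v \<in> O1 A \<alpha> \<union> O3 A \<alpha>"
    and inc: "phi u \<in> polar (figueroa_polarity A \<alpha> \<rho>) (phi v)"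
  shows "u \<in> polar \<rho> v"
proof (cases "v \<in> O1 A \<alpha>")
  case True
  then have "phi u \<in> polar \<rho> v"
    using inc by (simp add: phi_O1 figueroa_polarity_def)
  then have "phi u \<notin> O3 A \<alpha>"
    using O3_not_in_polar_O1 True by blast
  \<comment> \<open>\<open>phi\<close> sends \<open>O3\<close> into \<open>O3\<close>, so
    \<open>u\<close> cannot lie there.\<close>
  then have "u \<in> O1 A \<alpha>"
    using uv(1) phi_O3 pole_mu_O3 by auto
  then show ?thesis
    using \<open>phi u \<in> polar \<rho> v\<close> phi_O1 by simp
next
  case False
  then have v: "v \<in> O3 A \<alpha>"
    using uv by blast
  \<comment> \<open>This selects the second branch of \<open>figueroa_polarity\<close>, where the
    polar of \<open>phi v\<close> is the Figueroa line built from
    \<open>polar \<rho> (phi v) = mu_point A \<alpha> v\<close>.\<close>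
  then have "phi v \<notin> O1 A \<alpha> \<union> O2 A \<alpha>"
    using O3_disjoint pole_mu_O3 phi_O3 by metis
  then have inc': "phi u \<in> figueroa_line A \<alpha> (mu_point A \<alpha> v)"
    using inc v by (simp add: figueroa_polarity_def phi_O3 polar_pole_mu)
  show ?thesis
  proof (cases "u \<in> O1 A \<alpha>")
    case True
    then have "u \<in> mu_point A \<alpha> v"
      using inc' O3_disjoint by (auto simp: phi_O1 figueroa_line_def)
    then show ?thesis
      using O1_not_in_mu_point[OF v True] by blast
  next
    case False
    then have u: "u \<in> O3 A \<alpha>"
      using uv by blast
    then have "phi u \<in> O3 A \<alpha>"
      using phi_O3 pole_mu_O3 by simp
    \<comment> \<open>The \<open>O3\<close> part of \<open>figueroa_line\<close> applies, and
      applying \<mu> to the line \<open>mu_point A \<alpha> v\<close> returns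
      \<open>v\<close>.\<close>
    then have "v \<in> mu_point A \<alpha> (phi u)"
      using inc' O3_disjoint mu_line_mu_point[OF v] by (auto simp: figueroa_line_def)
    then have "v \<in> polar \<rho> u"
      using u by (simp add: phi_O3 mu_pole_mu)
    then show ?thesis
      using polar_sym O3D(1) u v by blast
  qed
qed

text \<open>This is the pullback of incidences in the case \<open>u = v\<close>.\<close>

lemma figueroa_set_not_absolute:
  assumes "\<forall>x\<in>Z. \<not> absolute \<rho> x" "y \<in> figueroa_set A \<alpha> \<rho> Z"
  shows "\<not> absolute (figueroa_polarity A \<alpha> \<rho>) y"
  using assms polar_if_figueroa_polar_phi
  unfolding figueroa_set_eq_phi absolute_def by blast

lemma figueroa_set_no_self_polar_triangle:
  assumes "\<not> (\<exists>T. T \<subseteq> Z \<and> self_polar_triangle \<rho> T)" "T \<subseteq> figueroa_set A \<alpha> \<rho> Z"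
  shows "\<not> self_polar_triangle (figueroa_polarity A \<alpha> \<rho>) T"
proof
  assume T: "self_polar_triangle (figueroa_polarity A \<alpha> \<rho>) T"
  \<comment> \<open>One preimage is chosen for each point of \<open>T\<close>, so \<open>S\<close>
    again has three elements and distinct points of \<open>S\<close> have distinct images.\<close>
  obtain S where S: "S \<subseteq> Z \<inter> (O1 A \<alpha> \<union> O3 A \<alpha>)" "inj_on phi S" "T = phi ` S"
    using assms(2) unfolding figueroa_set_eq_phi subset_image_inj by blast
  have "card S = 3"
    using T S by (simp add: self_polar_triangle_def card_image)
  moreover have "u \<in> polar \<rho> v" if "u \<in> S" "v \<in> S" "u \<noteq> v" for u v
  proof -
    have "phi u \<noteq> phi v"
      using that S(2) by (auto dest: inj_onD)
    then have "phi u \<in> polar (figueroa_polarity A \<alpha> \<rho>) (phi v)"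
      using T S(3) that unfolding self_polar_triangle_def by blast
    then show ?thesis
      using polar_if_figueroa_polar_phi S(1) that by blast
  qed
  ultimately have "self_polar_triangle \<rho> S"
    unfolding self_polar_triangle_def by blast
  with assms(1) S(1) show False by blast
qed

end

section \<open>Specialization to the plane over a field with \<open>q ^ 3\<close> elements\<close>

theorem theorem7:
  fixes q :: nat
    and \<alpha> :: "('a::{field,finite} ^ 3) set \<Rightarrow> ('a ^ 3) set"
    and \<rho> :: "('a ^ 3) set correlation"
    and Z :: "('a ^ 3) set set"
  assumes "primepow q" and "q > 2"
    and "CARD('a) = q ^ 3" and "CARD('b::{field,finite}) = q"
    and "collineation PG2 \<alpha>" and "has_order PG2 \<alpha> 3"
    and "isomorphic (fixed_substructure PG2 \<alpha>) (PG2 :: ('b ^ 3) set incidence_structure)"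
    and "polarity PG2 \<rho>" and "commutes_with PG2 \<rho> \<alpha>"
    and "Z \<subseteq> points PG2"
    and "\<forall>x\<in>Z. \<not> absolute \<rho> x"
    and "\<not> (\<exists>T. T \<subseteq> Z \<and> self_polar_triangle \<rho> T)"
  shows "figueroa_set PG2 \<alpha> \<rho> Z \<subseteq> points (figueroa PG2 \<alpha>) \<and>
    (\<forall>x\<in>figueroa_set PG2 \<alpha> \<rho> Z. \<not> absolute (figueroa_polarity PG2 \<alpha> \<rho>) x) \<and>
    \<not> (\<exists>T. T \<subseteq> figueroa_set PG2 \<alpha> \<rho> Z \<and>
           self_polar_triangle (figueroa_polarity PG2 \<alpha> \<rho>) T)"
proof -
  have "\<alpha> (\<alpha> (\<alpha> x)) = x" if "x \<in> points PG2" for x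
    using assms(6) that by (auto simp: has_order_def numeral_3_eq_3)
  then interpret polarity_space PG2 \<alpha> \<rho>
    using assms(5,8,9) PG2_unique_join by unfold_locales
  show ?thesis
    using figueroa_set_not_absolute[OF assms(11)]
      figueroa_set_no_self_polar_triangle[OF assms(12)] phi_point
    by (auto simp: figueroa_set_eq_phi figueroa_def)
qed

end
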